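(* Consider a Hamiltonian system $$\frac{dy^k}{dt}=f^k(\mathbf{y}):=\mathbf{J}_k^{-1}\frac{\partial H}{\partial y^k}(\mathbf{y}),\qquad y^k\in\mathbb{R}^{n_k},\ k=1,\dots,N,\qquad \mathbf{y}=(y^1,\dots,y^N),$$ where $H$ is a smooth real function and each $\mathbf{J}_k$ is a nonsingular, skew-symmetric $n_k\times n_k$ matrix. Apply the partitioned Runge--Kutta scheme with real coefficients $b_i^k,a_{ij}^k$ ($k=1,\dots,N$; $i,j=1,\dots,s$) and step size $h$, $$\tilde y^k=y^k+h\sum_{i=1}^s b_i^kF_i^k,\qquad Y_i^k=y^k+h\sum_{j=1}^s a_{ij}^kF_j^k,\qquad F_i^k=f^k(\mathbf{Y}_i),$$ where $\mathbf{Y}_i=(Y_i^1,\dots,Y_i^N)$. If the coefficients satisfy (i) $b_i^kb_j^k=b_i^ka_{ij}^k+b_j^ka_{ji}^k$ for all $i,j,k$, and (ii) $b_i^1=b_i^2=\dots=b_i^N$ for all $i$, then the scheme is symplectic: the update map $\mathbf{y}\mapsto\tilde{\mathbf{y}}$ preserves the symplectic form $\omega=\sum_{k=1}^N dy^k\wedge\mathbf{J}_k\,dy^k$.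
   Context: The update map $\mathbf{y}\mapsto\tilde{\mathbf{y}}$ is considered, as usual, on an open set of initial values (for the given $h$) on which the stage equations have a unique solution $(\mathbf{Y}_1,\dots,\mathbf{Y}_s)$ depending smoothly on $\mathbf{y}$. The form $dy^k\wedge\mathbf{J}_k\,dy^k$ means $\sum_{a,b}(\mathbf{J}_k)_{ab}\,dy^k_a\wedge dy^k_b$. *)

theory Defs
  imports "HOL-Analysis.Analysis"
begin

(* Meant for open S, since derivatives are not restricted to S.  Asking for every directional
   derivative to be of class C^n is the usual notion only on finite-dimensional domains. *)

primrec Cn_on ::
  "nat \<Rightarrow> 'a set \<Rightarrow> ('a::real_normed_vector \<Rightarrow> 'b::real_normed_vector) \<Rightarrow> bool" where
  "Cn_on 0 S f \<longleftrightarrow> continuous_on S f"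
| "Cn_on (Suc n) S f \<longleftrightarrow>
     (\<forall>x\<in>S. f differentiable (at x)) \<and>
     (\<forall>v. Cn_on n S (\<lambda>x. frechet_derivative f (at x) v))"

definition smooth_on ::
  "'a set \<Rightarrow> ('a::real_normed_vector \<Rightarrow> 'b::real_normed_vector) \<Rightarrow> bool" where
  "smooth_on S f \<longleftrightarrow> (\<forall>n. Cn_on n S f)"

(* The block sizes n_k depend on k, so the product of the spaces R^(n_k) is encoded as one space
   real ^ 'd together with a map blk :: 'd => 'k sending every scalar coordinate to the block it
   belongs to.  The component y^k of y consists of the coordinates y $ a with a in
   block blk k, and n_k = card (block blk k).  The index k ranges over the finite type 'k. *)

definition block :: "('d \<Rightarrow> 'k) \<Rightarrow> 'k \<Rightarrow> 'd set" where
  "block blk k = {a. blk a = k}"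

(* Square matrices whose rows and columns are indexed by a finite set I; entries outside I x I
   are junk and never used.  Same pattern as invertible and matrix_inv, which need
   the index set to be a type. *)

definition is_inverse_on :: "'d set \<Rightarrow> ('d \<Rightarrow> 'd \<Rightarrow> real) \<Rightarrow> ('d \<Rightarrow> 'd \<Rightarrow> real) \<Rightarrow> bool" where
  "is_inverse_on I A B \<longleftrightarrow>
     (\<forall>a\<in>I. \<forall>b\<in>I. (\<Sum>c\<in>I. A a c * B c b) = (if a = b then 1 else 0) \<and>
                    (\<Sum>c\<in>I. B a c * A c b) = (if a = b then 1 else 0))"

definition nonsingular_on :: "'d set \<Rightarrow> ('d \<Rightarrow> 'd \<Rightarrow> real) \<Rightarrow> bool" where
  "nonsingular_on I A \<longleftrightarrow> (\<exists>B. is_inverse_on I A B)"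

definition inverse_on :: "'d set \<Rightarrow> ('d \<Rightarrow> 'd \<Rightarrow> real) \<Rightarrow> 'd \<Rightarrow> 'd \<Rightarrow> real" where
  "inverse_on I A = (SOME B. is_inverse_on I A B)"

definition skew_symmetric_on :: "'d set \<Rightarrow> ('d \<Rightarrow> 'd \<Rightarrow> real) \<Rightarrow> bool" where
  "skew_symmetric_on I A \<longleftrightarrow> (\<forall>a\<in>I. \<forall>b\<in>I. A b a = - A a b)"

definition partial_deriv :: "(real ^ 'd \<Rightarrow> real) \<Rightarrow> 'd::finite \<Rightarrow> real ^ 'd \<Rightarrow> real" where
  "partial_deriv H a y = frechet_derivative H (at y) (axis a 1)"

(* Coordinate a of J_k^(-1) dH/dy^k, where k = blk a. *)
definition ham_field ::
  "('d \<Rightarrow> 'k) \<Rightarrow> ('k \<Rightarrow> 'd \<Rightarrow> 'd \<Rightarrow> real) \<Rightarrow> (real ^ 'd \<Rightarrow> real) \<Rightarrow>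
   real ^ 'd \<Rightarrow> real ^ 'd::finite" where
  "ham_field blk J H y =
     (\<chi> a. \<Sum>c\<in>block blk (blk a). inverse_on (block blk (blk a)) (J (blk a)) a c * partial_deriv H c y)"

(* Y $ i is the stage vector Y_i; b k i and A k i j are the coefficients b_i^k and a_ij^k. *)

definition prk_stage_eqs ::
  "('d \<Rightarrow> 'k) \<Rightarrow> ('k \<Rightarrow> 's \<Rightarrow> 's \<Rightarrow> real) \<Rightarrow> real \<Rightarrow>
   (real ^ 'd \<Rightarrow> real ^ 'd) \<Rightarrow> real ^ 'd::finite \<Rightarrow> real ^ 'd ^ 's::finite \<Rightarrow> bool" where
  "prk_stage_eqs blk A h f y Y \<longleftrightarrow>
     (\<forall>k i. \<forall>a\<in>block blk k. Y $ i $ a = y $ a + h * (\<Sum>j\<in>UNIV. A k i j * f (Y $ j) $ a))"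

definition prk_stages ::
  "('d \<Rightarrow> 'k) \<Rightarrow> ('k \<Rightarrow> 's \<Rightarrow> 's \<Rightarrow> real) \<Rightarrow> real \<Rightarrow>
   (real ^ 'd \<Rightarrow> real ^ 'd) \<Rightarrow> real ^ 'd::finite \<Rightarrow> real ^ 'd ^ 's::finite" where
  "prk_stages blk A h f y = (THE Y. prk_stage_eqs blk A h f y Y)"

definition prk_step ::
  "('d \<Rightarrow> 'k) \<Rightarrow> ('k \<Rightarrow> 's::finite \<Rightarrow> real) \<Rightarrow> ('k \<Rightarrow> 's \<Rightarrow> 's \<Rightarrow> real) \<Rightarrow> real \<Rightarrow>
   (real ^ 'd \<Rightarrow> real ^ 'd) \<Rightarrow> real ^ 'd::finite \<Rightarrow> real ^ 'd" where
  "prk_step blk b A h f y =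
     (\<chi> a. y $ a + h * (\<Sum>i\<in>UNIV. b (blk a) i * f (prk_stages blk A h f y $ i) $ a))"

(* The 2-forms below have constant coefficients, so they are given by a single bilinear form
   on the tangent space; dcoord a is the 1-form dy_a.  The wedge product is normalised without
   the factor 1/2. *)

definition dcoord :: "'d \<Rightarrow> real ^ 'd::finite \<Rightarrow> real" where
  "dcoord a u = u $ a"

definition wedge :: "('v \<Rightarrow> real) \<Rightarrow> ('v \<Rightarrow> real) \<Rightarrow> 'v \<Rightarrow> 'v \<Rightarrow> real" where
  "wedge \<alpha> \<beta> u v = \<alpha> u * \<beta> v - \<alpha> v * \<beta> u"

definition symp_form ::
  "('d \<Rightarrow> 'k) \<Rightarrow> ('k::finite \<Rightarrow> 'd \<Rightarrow> 'd \<Rightarrow> real) \<Rightarrow>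
   real ^ 'd::finite \<Rightarrow> real ^ 'd \<Rightarrow> real" where
  "symp_form blk J u v =
     (\<Sum>k\<in>UNIV. \<Sum>a\<in>block blk k. \<Sum>b\<in>block blk k. J k a b * wedge (dcoord a) (dcoord b) u v)"

(* The pullback of the constant 2-form \<omega> along \<phi> is \<omega> at every point of U.  Differentiability is
   part of the definition since frechet_derivative is unspecified without it. *)
definition preserves_form_on ::
  "'v set \<Rightarrow> ('v::real_normed_vector \<Rightarrow> 'v) \<Rightarrow> ('v \<Rightarrow> 'v \<Rightarrow> real) \<Rightarrow> bool" where
  "preserves_form_on U \<phi> \<omega> \<longleftrightarrow>
     (\<forall>y\<in>U. \<phi> differentiable (at y) \<and>
        (\<forall>u v. \<omega> (frechet_derivative \<phi> (at y) u) (frechet_derivative \<phi> (at y) v) = \<omega> u v))"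

end

theory Submission
  imports Defs
begin

text \<open>
  The scheme conserves quadratic quantities in the way an exact flow does, and this is applied to
  the variational equation. Write \<open>\<beta>\<^sub>k\<close> for the bilinear form of \<open>J\<^sub>k\<close>, so that the symplectic form
  is \<open>2 \<Sum>\<^sub>k \<beta>\<^sub>k\<close>. Differentiating the stage equations and the update at a point \<open>y\<close> in the
  directions \<open>u\<close> and \<open>v\<close> shows that the tangent vectors \<open>X\<^sub>i = DY\<^sub>i u\<close>, \<open>K\<^sub>i = Df(Y\<^sub>i) X\<^sub>i\<close> and their
  counterparts \<open>X'\<^sub>i\<close>, \<open>K'\<^sub>i\<close> for \<open>v\<close> obey the same Runge--Kutta relations as the \<open>Y\<^sub>i\<close> and
  \<open>F\<^sub>i\<close>. Expanding \<open>\<beta>\<^sub>k\<close> at the updated tangent vectors, and eliminating \<open>u\<close> and \<open>v\<close> from the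
  terms of first order in \<open>h\<close> in favour of \<open>X\<^sub>i\<close> and \<open>X'\<^sub>i\<close>, leaves a multiple of
  \<open>b\<^sub>i b\<^sub>j - b\<^sub>i a\<^sub>i\<^sub>j - b\<^sub>j a\<^sub>j\<^sub>i\<close> in every term of second order. Hence by condition (i)
  (lemma \<open>runge_kutta_bilinear\<close>) the value of \<open>\<beta>\<^sub>k\<close> at the updated tangent
  vectors is \<open>\<beta>\<^sub>k(u, v) + h \<Sum>\<^sub>i b\<^sub>i (\<beta>\<^sub>k(X\<^sub>i, K'\<^sub>i) + \<beta>\<^sub>k(K\<^sub>i, X'\<^sub>i))\<close>, with the coefficients
  of the \<open>k\<close>-th block.

  The remaining sum vanishes only after summation over \<open>k\<close>: the blocks are coupled through \<open>H\<close>, and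
  condition (ii) is what allows the weight \<open>b\<^sub>i\<close> to be taken out of the sum over \<open>k\<close>. Since \<open>J\<^sub>k\<close>
  cancels the \<open>J\<^sub>k\<^sup>-\<^sup>1\<close> in the vector field, \<open>\<Sum>\<^sub>k \<beta>\<^sub>k(X, K')\<close> is the Hessian of \<open>H\<close> applied to
  \<open>X\<close> and \<open>X'\<close>, and by skew symmetry \<open>\<Sum>\<^sub>k \<beta>\<^sub>k(K, X')\<close> is minus the Hessian applied to \<open>X'\<close>
  and \<open>X\<close>. Symmetry of the Hessian (lemma \<open>second_derivative_symmetric\<close>) gives zero.
\<close>

section \<open>Symmetry of second derivatives\<close>

lemma has_real_derivative_along_line:
  fixes F :: "'a::real_normed_vector \<Rightarrow> real"
  assumes "F differentiable (at (c + s *\<^sub>R u))"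
  shows "((\<lambda>r. F (c + r *\<^sub>R u)) has_real_derivative frechet_derivative F (at (c + s *\<^sub>R u)) u) (at s)"
proof -
  let ?D = "frechet_derivative F (at (c + s *\<^sub>R u))"
  have D: "(F has_derivative ?D) (at (c + s *\<^sub>R u))"
    using assms by (simp add: frechet_derivative_works)
  have "((\<lambda>r. c + r *\<^sub>R u) has_derivative (\<lambda>r. r *\<^sub>R u)) (at s)"
    by (auto intro!: derivative_eq_intros)
  from has_derivative_compose[OF this D]
  have "((\<lambda>r. F (c + r *\<^sub>R u)) has_derivative (\<lambda>r. ?D (r *\<^sub>R u))) (at s)" .
  moreover have "?D (r *\<^sub>R u) = ?D u * r" for r
    using linear_scale[OF has_derivative_linear[OF D]] by simp
  ultimately show ?thesis
    by (simp add: has_field_derivative_def)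
qed

definition second_difference ::
    "('a::real_normed_vector \<Rightarrow> real) \<Rightarrow> 'a \<Rightarrow> 'a \<Rightarrow> 'a \<Rightarrow> real \<Rightarrow> real" where
  "second_difference F x u v t =
     F (x + t *\<^sub>R u + t *\<^sub>R v) - F (x + t *\<^sub>R u) - F (x + t *\<^sub>R v) + F x"

lemma second_difference_commute:
  "second_difference F x u v t = second_difference F x v u t"
  by (simp add: second_difference_def algebra_simps)

text \<open>The mean value theorem is used twice, first in the direction \<open>u\<close> and then in the
  direction \<open>v\<close>.\<close>

lemma second_difference_mean_value:
  fixes F :: "'a::real_normed_vector \<Rightarrow> real"
  assumes dF: "\<And>x. F differentiable (at x)"
    and dDF: "\<And>x. (\<lambda>x. frechet_derivative F (at x) u) differentiable (at x)"
    and "0 < t"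
  obtains p q where "0 < p" "p < t" "0 < q" "q < t"
    "second_difference F x u v t =
       t\<^sup>2 * frechet_derivative (\<lambda>x. frechet_derivative F (at x) u) (at (x + p *\<^sub>R u + q *\<^sub>R v)) v"
proof -
  let ?D = "\<lambda>x. frechet_derivative F (at x) u"
  let ?g = "\<lambda>s. F ((x + t *\<^sub>R v) + s *\<^sub>R u) - F (x + s *\<^sub>R u)"
  have "(?g has_real_derivative ?D ((x + t *\<^sub>R v) + s *\<^sub>R u) - ?D (x + s *\<^sub>R u)) (at s)" for s
    by (intro DERIV_diff has_real_derivative_along_line dF)
  from MVT2[OF \<open>0 < t\<close> this] obtain p where p: "0 < p" "p < t"
    and g: "?g t - ?g 0 = (t - 0) * (?D ((x + t *\<^sub>R v) + p *\<^sub>R u) - ?D (x + p *\<^sub>R u))"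
    by blast
  let ?k = "\<lambda>s. ?D ((x + p *\<^sub>R u) + s *\<^sub>R v)"
  have "(?k has_real_derivative frechet_derivative ?D (at ((x + p *\<^sub>R u) + s *\<^sub>R v)) v) (at s)" for s
    by (intro has_real_derivative_along_line dDF)
  from MVT2[OF \<open>0 < t\<close> this] obtain q where q: "0 < q" "q < t"
    and k: "?k t - ?k 0 = (t - 0) * frechet_derivative ?D (at ((x + p *\<^sub>R u) + q *\<^sub>R v)) v"
    by blast
  have "second_difference F x u v t = ?g t - ?g 0"
    by (simp add: second_difference_def algebra_simps)
  also have "\<dots> = t * (?k t - ?k 0)"
    using g by (simp add: algebra_simps)
  also have "\<dots> = t\<^sup>2 * frechet_derivative ?D (at (x + p *\<^sub>R u + q *\<^sub>R v)) v"
    using k by (simp add: power2_eq_square)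
  finally show ?thesis using that p q by blast
qed

lemma second_difference_tendsto:
  fixes F :: "'a::real_normed_vector \<Rightarrow> real"
  assumes dF: "\<And>x. F differentiable (at x)"
    and dDF: "\<And>x. (\<lambda>x. frechet_derivative F (at x) u) differentiable (at x)"
    and cont: "continuous_on UNIV
      (\<lambda>x. frechet_derivative (\<lambda>x. frechet_derivative F (at x) u) (at x) v)"
  shows "((\<lambda>t. second_difference F x u v t / t\<^sup>2) \<longlongrightarrow>
    frechet_derivative (\<lambda>x. frechet_derivative F (at x) u) (at x) v) (at_right 0)"
proof -
  define G where "G = (\<lambda>x. frechet_derivative (\<lambda>x. frechet_derivative F (at x) u) (at x) v)"
  have "\<exists>z. norm (z - x) \<le> t * (norm u + norm v) \<and> second_difference F x u v t / t\<^sup>2 = G z"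
    if "0 < t" for t
  proof -
    obtain p q where pq: "0 < p" "p < t" "0 < q" "q < t"
      and eq: "second_difference F x u v t = t\<^sup>2 * G (x + p *\<^sub>R u + q *\<^sub>R v)"
      using second_difference_mean_value[OF dF dDF \<open>0 < t\<close>] unfolding G_def by metis
    have "norm (p *\<^sub>R u + q *\<^sub>R v) \<le> p * norm u + q * norm v"
      using norm_triangle_ineq[of "p *\<^sub>R u" "q *\<^sub>R v"] pq by simp
    also have "\<dots> \<le> t * (norm u + norm v)"
      using pq by (simp add: distrib_left add_mono mult_right_mono)
    finally show ?thesis
      using eq \<open>0 < t\<close> by (intro exI[of _ "x + p *\<^sub>R u + q *\<^sub>R v"]) (simp add: add.assoc)
  qed
  then obtain z where
    z: "\<And>t. 0 < t \<Longrightarrow> norm (z t - x) \<le> t * (norm u + norm v) \<and> second_difference F x u v t / t\<^sup>2 = G (z t)"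
    by metis
  have pos: "\<forall>\<^sub>F t in at_right (0::real). 0 < t"
    by (simp add: eventually_at_right_less)
  have "((\<lambda>t. t * (norm u + norm v)) \<longlongrightarrow> 0 * (norm u + norm v)) (at_right 0)"
    by (intro tendsto_intros)
  then have "((\<lambda>t. z t - x) \<longlongrightarrow> 0) (at_right 0)"
    by (intro Lim_null_comparison[of "\<lambda>t. z t - x" "\<lambda>t. t * (norm u + norm v)"]
          eventually_mono[OF pos]) (auto dest: z)
  then have "(z \<longlongrightarrow> x) (at_right 0)"
    by (simp add: Lim_null[of z])
  moreover have "isCont G x"
    using cont by (simp add: G_def continuous_on_eq_continuous_at)
  ultimately have "((\<lambda>t. G (z t)) \<longlongrightarrow> G x) (at_right 0)"
    by (rule isCont_tendsto_compose[rotated])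
  moreover have "\<forall>\<^sub>F t in at_right 0. G (z t) = second_difference F x u v t / t\<^sup>2"
    by (rule eventually_mono[OF pos]) (simp add: z)
  ultimately show ?thesis
    unfolding G_def by (rule Lim_transform_eventually)
qed

text \<open>Both iterated derivatives are limits of the same second difference quotient.\<close>

lemma second_derivative_symmetric:
  fixes F :: "'a::real_normed_vector \<Rightarrow> real"
  assumes "Cn_on 2 UNIV F"
  shows "frechet_derivative (\<lambda>x. frechet_derivative F (at x) u) (at x) v =
    frechet_derivative (\<lambda>x. frechet_derivative F (at x) v) (at x) u"
proof -
  have C: "\<And>x. F differentiable (at x)"
    "\<And>w x. (\<lambda>x. frechet_derivative F (at x) w) differentiable (at x)"
    "\<And>w w'. continuous_on UNIV
      (\<lambda>x. frechet_derivative (\<lambda>x. frechet_derivative F (at x) w) (at x) w')"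
    using assms by (simp_all add: numeral_2_eq_2)
  show ?thesis
  proof (rule tendsto_unique[of "at_right (0::real)"])
    show "((\<lambda>t. second_difference F x u v t / t\<^sup>2) \<longlongrightarrow>
        frechet_derivative (\<lambda>x. frechet_derivative F (at x) u) (at x) v) (at_right 0)"
      by (intro second_difference_tendsto C)
    show "((\<lambda>t. second_difference F x u v t / t\<^sup>2) \<longlongrightarrow>
        frechet_derivative (\<lambda>x. frechet_derivative F (at x) v) (at x) u) (at_right 0)"
      unfolding second_difference_commute[of F x u v] by (intro second_difference_tendsto C)
  qed simp
qed

section \<open>Runge--Kutta steps and bilinear forms\<close>

text \<open>The exact flow satisfies \<open>d/dt \<beta>(X, X') = \<beta>(X, K') + \<beta>(K, X')\<close>; under the condition on the
  coefficients the scheme integrates this identity with its own quadrature weights. The stages are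
  written out so that the lemma can be applied to forms that see only one block of coordinates.\<close>

lemma runge_kutta_bilinear:
  fixes \<beta> :: "'a::real_vector \<Rightarrow> 'a \<Rightarrow> real"
    and b :: "'s::finite \<Rightarrow> real"
  assumes \<beta>: "bilinear \<beta>"
    and coeff: "\<And>i j. b i * b j = b i * A i j + b j * A j i"
  shows "\<beta> (u + h *\<^sub>R (\<Sum>i\<in>UNIV. b i *\<^sub>R K i)) (v + h *\<^sub>R (\<Sum>i\<in>UNIV. b i *\<^sub>R K' i)) =
    \<beta> u v + h * (\<Sum>i\<in>UNIV. b i *
      (\<beta> (u + h *\<^sub>R (\<Sum>j\<in>UNIV. A i j *\<^sub>R K j)) (K' i) +
       \<beta> (K i) (v + h *\<^sub>R (\<Sum>j\<in>UNIV. A i j *\<^sub>R K' j))))"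
proof -
  have suml: "\<beta> (\<Sum>i\<in>UNIV. c i *\<^sub>R p i) w = (\<Sum>i\<in>UNIV. c i * \<beta> (p i) w)"
    for c :: "'s \<Rightarrow> real" and p w
  proof -
    have lin: "linear (\<lambda>x. \<beta> x w)" using \<beta> by (simp add: bilinear_def)
    show ?thesis by (simp add: linear_sum[OF lin] bilinear_lmul[OF \<beta>])
  qed
  have sumr: "\<beta> w (\<Sum>i\<in>UNIV. c i *\<^sub>R p i) = (\<Sum>i\<in>UNIV. c i * \<beta> w (p i))"
    for c :: "'s \<Rightarrow> real" and p w
  proof -
    have lin: "linear (\<beta> w)" using \<beta> by (simp add: bilinear_def)
    show ?thesis by (simp add: linear_sum[OF lin] bilinear_rmul[OF \<beta>])
  qed
  note expand = bilinear_ladd[OF \<beta>] bilinear_radd[OF \<beta>] bilinear_lmul[OF \<beta>] bilinear_rmul[OF \<beta>]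
    suml sumr
  have "(\<Sum>i\<in>UNIV. b i * (\<Sum>j\<in>UNIV. b j * \<beta> (K i) (K' j))) =
      (\<Sum>i\<in>UNIV. \<Sum>j\<in>UNIV. b j * A j i * \<beta> (K i) (K' j)) +
      (\<Sum>i\<in>UNIV. \<Sum>j\<in>UNIV. b i * A i j * \<beta> (K i) (K' j))"
    by (simp add: sum_distrib_left mult.assoc[symmetric] coeff distrib_right sum.distrib)
  also have "(\<Sum>i\<in>UNIV. \<Sum>j\<in>UNIV. b j * A j i * \<beta> (K i) (K' j)) =
      (\<Sum>i\<in>UNIV. \<Sum>j\<in>UNIV. b i * A i j * \<beta> (K j) (K' i))"
    by (rule sum.swap)
  finally have second: "(\<Sum>i\<in>UNIV. b i * (\<Sum>j\<in>UNIV. b j * \<beta> (K i) (K' j))) =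
      (\<Sum>i\<in>UNIV. b i * (\<Sum>j\<in>UNIV. A i j * \<beta> (K j) (K' i))) +
      (\<Sum>i\<in>UNIV. b i * (\<Sum>j\<in>UNIV. A i j * \<beta> (K i) (K' j)))"
    by (simp add: sum_distrib_left mult.assoc)
  have split: "(\<Sum>i\<in>UNIV. b i * (p i + h * q i)) = (\<Sum>i\<in>UNIV. b i * p i) + h * (\<Sum>i\<in>UNIV. b i * q i)"
    for p q :: "'s \<Rightarrow> real"
    by (simp add: distrib_left sum.distrib sum_distrib_left mult.left_commute)
  have left: "\<beta> (u + h *\<^sub>R (\<Sum>i\<in>UNIV. b i *\<^sub>R K i)) (v + h *\<^sub>R (\<Sum>i\<in>UNIV. b i *\<^sub>R K' i)) =
      \<beta> u v + h * (\<Sum>i\<in>UNIV. b i * \<beta> u (K' i)) + h * ((\<Sum>i\<in>UNIV. b i * \<beta> (K i) v) +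
      h * (\<Sum>i\<in>UNIV. b i * (\<Sum>j\<in>UNIV. b j * \<beta> (K i) (K' j))))"
    \<comment> \<open>The left argument has to be expanded first, to obtain the double sum with \<open>K i\<close> outside.\<close>
    by (simp only: bilinear_ladd[OF \<beta>] bilinear_lmul[OF \<beta>] suml real_scaleR_def,
      simp only: expand split real_scaleR_def add.assoc)
  have right: "(\<Sum>i\<in>UNIV. b i *
      (\<beta> (u + h *\<^sub>R (\<Sum>j\<in>UNIV. A i j *\<^sub>R K j)) (K' i) +
       \<beta> (K i) (v + h *\<^sub>R (\<Sum>j\<in>UNIV. A i j *\<^sub>R K' j)))) =
      (\<Sum>i\<in>UNIV. b i * \<beta> u (K' i)) + h * (\<Sum>i\<in>UNIV. b i * (\<Sum>j\<in>UNIV. A i j * \<beta> (K j) (K' i))) +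
      ((\<Sum>i\<in>UNIV. b i * \<beta> (K i) v) + h * (\<Sum>i\<in>UNIV. b i * (\<Sum>j\<in>UNIV. A i j * \<beta> (K i) (K' j))))"
    by (simp only: expand real_scaleR_def distrib_left[of "b _" "_ + _" "_ + _"] sum.distrib split)
  show ?thesis
    unfolding left right second by (simp only: distrib_left add_ac)
qed

section \<open>The form of a block and the Hamiltonian field\<close>

definition block_form :: "'d set \<Rightarrow> ('d \<Rightarrow> 'd \<Rightarrow> real) \<Rightarrow> real ^ 'd::finite \<Rightarrow> real ^ 'd \<Rightarrow> real" where
  "block_form I M u v = (\<Sum>a\<in>I. \<Sum>c\<in>I. M a c * u $ a * v $ c)"

lemma bilinear_block_form: "bilinear (block_form I M)"
  unfolding bilinear_def block_form_def
  by (intro conjI allI linearI)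
    (simp_all add: algebra_simps sum.distrib sum_distrib_left)

lemma block_form_cong:
  assumes "\<And>a. a \<in> I \<Longrightarrow> u $ a = u' $ a" and "\<And>a. a \<in> I \<Longrightarrow> v $ a = v' $ a"
  shows "block_form I M u v = block_form I M u' v'"
  unfolding block_form_def using assms by (intro sum.cong) auto

lemma block_form_skew:
  assumes "skew_symmetric_on I M"
  shows "block_form I M v u = - block_form I M u v"
proof -
  have "block_form I M v u = (\<Sum>c\<in>I. \<Sum>a\<in>I. M a c * v $ a * u $ c)"
    unfolding block_form_def by (rule sum.swap)
  also have "\<dots> = (\<Sum>c\<in>I. \<Sum>a\<in>I. - (M c a * u $ c * v $ a))"
  proof (intro sum.cong refl)
    fix c a assume "c \<in> I" "a \<in> I"
    then have "M a c = - M c a"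
      using assms unfolding skew_symmetric_on_def by blast
    then show "M a c * v $ a * u $ c = - (M c a * u $ c * v $ a)"
      by simp
  qed
  finally show ?thesis
    by (simp add: block_form_def sum_negf)
qed

lemma symp_form_eq_block_form:
  assumes "\<And>k. skew_symmetric_on (block blk k) (J k)"
  shows "symp_form blk J u v = 2 * (\<Sum>k\<in>UNIV. block_form (block blk k) (J k) u v)"
proof -
  have "symp_form blk J u v =
      (\<Sum>k\<in>UNIV. block_form (block blk k) (J k) u v - block_form (block blk k) (J k) v u)"
    by (simp only: symp_form_def block_form_def wedge_def dcoord_def sum_subtractf[symmetric]
        right_diff_distrib mult.assoc)
  then show ?thesis
    by (simp add: block_form_skew[OF assms, of _ v u] sum_distrib_left)
qed

lemma block_form_inverse:
  assumes "nonsingular_on I M"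
    and w: "\<And>a. a \<in> I \<Longrightarrow> w $ a = (\<Sum>c\<in>I. inverse_on I M a c * g c)"
  shows "block_form I M u w = (\<Sum>a\<in>I. u $ a * g a)"
proof -
  have "is_inverse_on I M (inverse_on I M)"
    using assms(1) unfolding nonsingular_on_def inverse_on_def by (rule someI_ex)
  then have inv: "(\<Sum>c\<in>I. M a c * inverse_on I M c e) = (if a = e then 1 else 0)"
    if "a \<in> I" "e \<in> I" for a e
    using that by (auto simp: is_inverse_on_def)
  have "(\<Sum>c\<in>I. M a c * w $ c) = g a" if a: "a \<in> I" for a
  proof -
    have "(\<Sum>c\<in>I. M a c * w $ c) = (\<Sum>c\<in>I. \<Sum>e\<in>I. M a c * inverse_on I M c e * g e)"
      by (simp add: w sum_distrib_left mult.assoc)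
    also have "\<dots> = (\<Sum>e\<in>I. (\<Sum>c\<in>I. M a c * inverse_on I M c e) * g e)"
      by (subst sum.swap) (simp add: sum_distrib_right)
    also have "\<dots> = (\<Sum>e\<in>I. if a = e then g e else 0)"
      using a by (intro sum.cong) (auto simp: inv)
    finally show ?thesis using a by (simp add: sum.delta')
  qed
  then have "(\<Sum>a\<in>I. u $ a * (\<Sum>c\<in>I. M a c * w $ c)) = (\<Sum>a\<in>I. u $ a * g a)"
    by simp
  then show ?thesis
    by (simp add: block_form_def sum_distrib_left mult_ac)
qed

lemma sum_blocks:
  fixes blk :: "'d::finite \<Rightarrow> 'k::finite" and g :: "'d \<Rightarrow> real"
  shows "(\<Sum>k\<in>UNIV. \<Sum>a\<in>block blk k. g a) = (\<Sum>a\<in>UNIV. g a)"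
  using sum.group[of UNIV UNIV blk g] by (simp add: block_def)

lemma has_derivative_vec_lambda:
  fixes f :: "'a::real_normed_vector \<Rightarrow> 'd::finite \<Rightarrow> real"
  assumes "\<And>a. ((\<lambda>x. f x a) has_derivative (\<lambda>u. f' u a)) (at x)"
  shows "((\<lambda>x. \<chi> a. f x a) has_derivative (\<lambda>u. \<chi> a. f' u a)) (at x)"
  using assms by (subst has_derivative_componentwise_within) (auto simp: Basis_vec_def inner_axis)

lemma partial_deriv_differentiable:
  assumes "Cn_on 2 UNIV H"
  shows "partial_deriv H c differentiable (at x)"
  using assms by (simp add: numeral_2_eq_2 partial_deriv_def[abs_def])

lemma ham_field_has_derivative:
  assumes "Cn_on 2 UNIV H"
  shows "(ham_field blk J H has_derivative (\<lambda>w. \<chi> a. \<Sum>c\<in>block blk (blk a).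
      inverse_on (block blk (blk a)) (J (blk a)) a c * frechet_derivative (partial_deriv H c) (at x) w))
    (at x)"
proof -
  have "(partial_deriv H c has_derivative frechet_derivative (partial_deriv H c) (at x)) (at x)" for c
    using partial_deriv_differentiable[OF assms] by (simp add: frechet_derivative_works)
  then show ?thesis
    unfolding ham_field_def[abs_def]
    by (intro has_derivative_vec_lambda has_derivative_sum has_derivative_mult_right)
qed

text \<open>This is the Hessian of \<open>H\<close> at \<open>x\<close> as a quadratic expression in \<open>u\<close> and \<open>v\<close>, symmetric
  because it is so on pairs of coordinate vectors.\<close>

lemma hessian_symmetric:
  fixes H :: "real ^ 'd::finite \<Rightarrow> real"
  assumes "Cn_on 2 UNIV H"
  shows "(\<Sum>a\<in>UNIV. u $ a * frechet_derivative (partial_deriv H a) (at x) v) =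
    (\<Sum>a\<in>UNIV. v $ a * frechet_derivative (partial_deriv H a) (at x) u)"
proof -
  define G where "G a = frechet_derivative (partial_deriv H a) (at x)" for a
  have lin: "linear (G a)" for a
    unfolding G_def using partial_deriv_differentiable[OF assms] by (rule linear_frechet_derivative)
  have coords: "G a w = (\<Sum>c\<in>UNIV. w $ c * G a (axis c 1))" for a w
  proof -
    have "G a w = G a (\<Sum>c\<in>UNIV. w $ c *\<^sub>R axis c 1)"
      using basis_expansion[of w] by (simp add: scalar_mult_eq_scaleR)
    also have "\<dots> = (\<Sum>c\<in>UNIV. w $ c * G a (axis c 1))"
      by (simp add: linear_sum[OF lin] linear_scale[OF lin])
    finally show ?thesis .
  qed
  have sym: "G a (axis c 1) = G c (axis a 1)" for a c
    unfolding G_def partial_deriv_def[abs_def] by (rule second_derivative_symmetric[OF assms])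
  have "(\<Sum>a\<in>UNIV. u $ a * G a v) = (\<Sum>a\<in>UNIV. \<Sum>c\<in>UNIV. u $ a * v $ c * G a (axis c 1))"
    by (subst coords) (simp add: sum_distrib_left mult.assoc)
  also have "\<dots> = (\<Sum>c\<in>UNIV. \<Sum>a\<in>UNIV. u $ a * v $ c * G a (axis c 1))"
    by (rule sum.swap)
  also have "\<dots> = (\<Sum>c\<in>UNIV. \<Sum>a\<in>UNIV. v $ c * u $ a * G c (axis a 1))"
    by (simp add: sym mult.commute)
  also have "\<dots> = (\<Sum>c\<in>UNIV. v $ c * G c u)"
    by (subst (2) coords) (simp add: sum_distrib_left mult.assoc)
  finally show ?thesis by (simp add: G_def)
qed

text \<open>This is the infinitesimal statement that Hamiltonian flows are symplectic: the linearised field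
  is skew with respect to the symplectic form.\<close>

lemma ham_field_infinitesimally_symplectic:
  fixes blk :: "'d::finite \<Rightarrow> 'k::finite"
  assumes nonsing: "\<And>k. nonsingular_on (block blk k) (J k)"
    and skew: "\<And>k. skew_symmetric_on (block blk k) (J k)"
    and H: "Cn_on 2 UNIV H"
    and f': "(ham_field blk J H has_derivative f') (at x)"
  shows "(\<Sum>k\<in>UNIV. block_form (block blk k) (J k) u (f' v) + block_form (block blk k) (J k) (f' u) v) = 0"
proof -
  have f'_eq: "f' = (\<lambda>w. \<chi> a. \<Sum>c\<in>block blk (blk a). inverse_on (block blk (blk a)) (J (blk a)) a c *
      frechet_derivative (partial_deriv H c) (at x) w)"
    using f' ham_field_has_derivative[OF H] by (rule has_derivative_unique)
  have "block_form (block blk k) (J k) p (f' w) =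
      (\<Sum>a\<in>block blk k. p $ a * frechet_derivative (partial_deriv H a) (at x) w)" for k p w
    by (rule block_form_inverse[OF nonsing]) (auto simp: f'_eq block_def)
  then have hess: "(\<Sum>k\<in>UNIV. block_form (block blk k) (J k) p (f' w)) =
      (\<Sum>a\<in>UNIV. p $ a * frechet_derivative (partial_deriv H a) (at x) w)" for p w
    by (simp add: sum_blocks)
  have "(\<Sum>k\<in>UNIV. block_form (block blk k) (J k) u (f' v) + block_form (block blk k) (J k) (f' u) v) =
      (\<Sum>k\<in>UNIV. block_form (block blk k) (J k) u (f' v)) -
      (\<Sum>k\<in>UNIV. block_form (block blk k) (J k) v (f' u))"
    by (simp add: block_form_skew[OF skew, where v = v] sum.distrib sum_negf)
  then show ?thesis
    using hessian_symmetric[OF H, of u x v] by (simp add: hess)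
qed

section \<open>The linearised scheme\<close>

text \<open>The stages are characterised only by the stage equations, so their derivative is compared with
  that of the right-hand side near \<open>y\<close>; this is where \<open>U\<close> must be open.\<close>

lemma prk_stages_derivative:
  fixes Y :: "real ^ 'd::finite \<Rightarrow> real ^ 'd ^ 's::finite"
  assumes "open U" "y \<in> U"
    and eqs: "\<And>y. y \<in> U \<Longrightarrow> prk_stage_eqs blk A h f y (Y y)"
    and Y': "(Y has_derivative Y') (at y)"
    and f': "\<And>j. (f has_derivative f' j) (at (Y y $ j))"
  shows "Y' u $ i $ a = u $ a + h * (\<Sum>j\<in>UNIV. A (blk a) i j * f' j (Y' u $ j) $ a)"
proof -
  have stage: "((\<lambda>z. Y z $ j) has_derivative (\<lambda>u. Y' u $ j)) (at y)" for j
    by (rule bounded_linear.has_derivative[OF bounded_linear_vec_nth Y'])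
  have field: "((\<lambda>z. f (Y z $ j) $ a) has_derivative (\<lambda>u. f' j (Y' u $ j) $ a)) (at y)" for j
    by (rule bounded_linear.has_derivative[OF bounded_linear_vec_nth
          has_derivative_compose[OF stage f']])
  have "((\<lambda>z. z $ a + h * (\<Sum>j\<in>UNIV. A (blk a) i j * f (Y z $ j) $ a)) has_derivative
      (\<lambda>u. u $ a + h * (\<Sum>j\<in>UNIV. A (blk a) i j * f' j (Y' u $ j) $ a))) (at y)"
    by (intro has_derivative_add has_derivative_mult_right has_derivative_sum field
          bounded_linear.has_derivative[OF bounded_linear_vec_nth has_derivative_ident])
  then have "((\<lambda>z. Y z $ i $ a) has_derivative
      (\<lambda>u. u $ a + h * (\<Sum>j\<in>UNIV. A (blk a) i j * f' j (Y' u $ j) $ a))) (at y)"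
    using \<open>open U\<close> \<open>y \<in> U\<close>
    by (rule has_derivative_transform_within_open)
      (use eqs in \<open>simp add: prk_stage_eqs_def block_def\<close>)
  with bounded_linear.has_derivative[OF bounded_linear_vec_nth stage]
  have "(\<lambda>u. Y' u $ i $ a) = (\<lambda>u. u $ a + h * (\<Sum>j\<in>UNIV. A (blk a) i j * f' j (Y' u $ j) $ a))"
    by (rule has_derivative_unique)
  then show ?thesis by metis
qed

lemma prk_step_has_derivative:
  assumes Y': "(prk_stages blk A h f has_derivative Y') (at y)"
    and f': "\<And>i. (f has_derivative f' i) (at (prk_stages blk A h f y $ i))"
  shows "(prk_step blk b A h f has_derivative
    (\<lambda>u. \<chi> a. u $ a + h * (\<Sum>i\<in>UNIV. b (blk a) i * f' i (Y' u $ i) $ a))) (at y)"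
proof -
  have "((\<lambda>z. f (prk_stages blk A h f z $ i) $ a) has_derivative (\<lambda>u. f' i (Y' u $ i) $ a)) (at y)"
    for i a
    by (rule bounded_linear.has_derivative[OF bounded_linear_vec_nth
          has_derivative_compose[OF bounded_linear.has_derivative[OF bounded_linear_vec_nth Y'] f']])
  then show ?thesis
    unfolding prk_step_def[abs_def]
    by (intro has_derivative_vec_lambda has_derivative_add has_derivative_mult_right has_derivative_sum
          bounded_linear.has_derivative[OF bounded_linear_vec_nth has_derivative_ident])
qed

section \<open>Symplecticity\<close>

theorem corollary5p2:
  fixes blk :: "'d::finite \<Rightarrow> 'k::finite"
    and J :: "'k \<Rightarrow> 'd \<Rightarrow> 'd \<Rightarrow> real"
    and H :: "real ^ 'd \<Rightarrow> real"
    and b :: "'k \<Rightarrow> 's::finite \<Rightarrow> real"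
    and A :: "'k \<Rightarrow> 's \<Rightarrow> 's \<Rightarrow> real"
    and h :: real
    and U :: "(real ^ 'd) set"
  assumes "\<And>k. nonsingular_on (block blk k) (J k)"
    and "\<And>k. skew_symmetric_on (block blk k) (J k)"
    and "smooth_on UNIV H"
    and "open U"
    and "\<And>y. y \<in> U \<Longrightarrow> \<exists>!Y. prk_stage_eqs blk A h (ham_field blk J H) y Y"
    and "smooth_on U (prk_stages blk A h (ham_field blk J H))"
    and "\<And>i j k. b k i * b k j = b k i * A k i j + b k j * A k j i"
    and "\<And>i k l. b k i = b l i"
  shows "preserves_form_on U (prk_step blk b A h (ham_field blk J H)) (symp_form blk J)"
  unfolding preserves_form_on_def
proof (intro ballI conjI allI)
  fix y assume y: "y \<in> U"
  let ?f = "ham_field blk J H"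
  let ?Y = "prk_stages blk A h ?f"
  let ?step = "prk_step blk b A h ?f"
  have H: "Cn_on 2 UNIV H"
    using assms(3) by (simp add: smooth_on_def)
  obtain f' where f': "\<And>i. (?f has_derivative f' i) (at (?Y y $ i))"
    by (rule that, rule ham_field_has_derivative[OF H])
  have "Cn_on (Suc 0) U ?Y"
    using assms(6) unfolding smooth_on_def by blast
  then obtain Y' where Y': "(?Y has_derivative Y') (at y)"
    using y by (auto simp: differentiable_def)
  have eqs: "prk_stage_eqs blk A h ?f z (?Y z)" if "z \<in> U" for z
    unfolding prk_stages_def using assms(5)[OF that] by (rule theI')
  define X where "X u i = Y' u $ i" for u i
  define K where "K u i = f' i (X u i)" for u i
  have X: "X u i $ a = u $ a + h * (\<Sum>j\<in>UNIV. A (blk a) i j * K u j $ a)" for u i a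
    unfolding X_def K_def by (rule prk_stages_derivative[OF assms(4) y eqs Y' f'])
  define S where "S u = (\<chi> a. u $ a + h * (\<Sum>i\<in>UNIV. b (blk a) i * K u i $ a))" for u
  have step: "(?step has_derivative S) (at y)"
    unfolding S_def K_def X_def by (rule prk_step_has_derivative[OF Y' f'])
  then show "?step differentiable (at y)"
    by (rule differentiableI)
  have deriv: "frechet_derivative ?step (at y) = S"
    using frechet_derivative_at[OF step] by simp
  fix u v
  let ?\<beta> = "\<lambda>k. block_form (block blk k) (J k)"
  have blocks: "?\<beta> k (S u) (S v) = ?\<beta> k u v +
      h * (\<Sum>i\<in>UNIV. b k i * (?\<beta> k (X u i) (K v i) + ?\<beta> k (K u i) (X v i)))" for k
  proof -
    have *: "S w $ a = (w + h *\<^sub>R (\<Sum>i\<in>UNIV. b k i *\<^sub>R K w i)) $ a"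
      "X w i $ a = (w + h *\<^sub>R (\<Sum>j\<in>UNIV. A k i j *\<^sub>R K w j)) $ a"
      if "a \<in> block blk k" for w i a
      using that X[of w i a] by (simp_all add: S_def block_def)
    have stage_left: "?\<beta> k (X u i) (K v i) = ?\<beta> k (u + h *\<^sub>R (\<Sum>j\<in>UNIV. A k i j *\<^sub>R K u j)) (K v i)" for i
      by (intro block_form_cong * refl)
    have stage_right: "?\<beta> k (K u i) (X v i) = ?\<beta> k (K u i) (v + h *\<^sub>R (\<Sum>j\<in>UNIV. A k i j *\<^sub>R K v j))" for i
      by (intro block_form_cong * refl)
    have "?\<beta> k (S u) (S v) = ?\<beta> k (u + h *\<^sub>R (\<Sum>i\<in>UNIV. b k i *\<^sub>R K u i))
        (v + h *\<^sub>R (\<Sum>i\<in>UNIV. b k i *\<^sub>R K v i))"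
      by (intro block_form_cong *)
    also have "\<dots> = ?\<beta> k u v + h * (\<Sum>i\<in>UNIV. b k i *
        (?\<beta> k (u + h *\<^sub>R (\<Sum>j\<in>UNIV. A k i j *\<^sub>R K u j)) (K v i) +
         ?\<beta> k (K u i) (v + h *\<^sub>R (\<Sum>j\<in>UNIV. A k i j *\<^sub>R K v j))))"
      by (rule runge_kutta_bilinear[OF bilinear_block_form assms(7)])
    also have "\<dots> = ?\<beta> k u v + h * (\<Sum>i\<in>UNIV. b k i *
        (?\<beta> k (X u i) (K v i) + ?\<beta> k (K u i) (X v i)))"
      unfolding stage_left stage_right ..
    finally show ?thesis .
  qed
  \<comment> \<open>The common weights, written as those of an arbitrary block.\<close>
  define w where "w = b undefined"
  have w: "b k i = w i" for k i
    unfolding w_def by (rule assms(8))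
  have "(\<Sum>k\<in>UNIV. \<Sum>i\<in>UNIV. b k i * (?\<beta> k (X u i) (K v i) + ?\<beta> k (K u i) (X v i))) =
      (\<Sum>i\<in>UNIV. \<Sum>k\<in>UNIV. w i * (?\<beta> k (X u i) (K v i) + ?\<beta> k (K u i) (X v i)))"
    unfolding w by (rule sum.swap)
  also have "\<dots> = (\<Sum>i\<in>UNIV. w i * (\<Sum>k\<in>UNIV. ?\<beta> k (X u i) (K v i) + ?\<beta> k (K u i) (X v i)))"
    by (simp add: sum_distrib_left)
  also have "\<dots> = 0"
    unfolding K_def
    by (simp only: ham_field_infinitesimally_symplectic[OF assms(1,2) H f'] mult_zero_right
        sum.neutral_const)
  finally have "(\<Sum>k\<in>UNIV. h * (\<Sum>i\<in>UNIV. b k i *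
      (?\<beta> k (X u i) (K v i) + ?\<beta> k (K u i) (X v i)))) = 0"
    by (subst sum_distrib_left[symmetric]) simp
  then have "(\<Sum>k\<in>UNIV. ?\<beta> k (S u) (S v)) = (\<Sum>k\<in>UNIV. ?\<beta> k u v)"
    unfolding blocks by (subst sum.distrib) simp
  then show "symp_form blk J (frechet_derivative ?step (at y) u) (frechet_derivative ?step (at y) v) =
      symp_form blk J u v"
    by (simp only: deriv symp_form_eq_block_form[OF assms(2)])
qed

end
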